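(* Let $n,m\ge 2$, $k\ge 1$ and $\lambda_2\ge 1$ be integers, and let $\mathcal D=(\mathcal P,\mathcal G,\mathcal B)$ be a group divisible design with the dual property with parameters $(n,m;k;0,\lambda_2)$, i.e. a $\mathrm{GDDDP}(n,m;k;0,\lambda_2)$. Let $\Gamma$ be the point-block incidence graph of $\mathcal D$, and write $k_4:=n-1$, $c_2:=\lambda_2$, $b_2':=k_4c_2$ and $b_2'':=k-(k_4+1)c_2$. For a vertex $x$ let $\Gamma_i(x)$ denote the set of vertices at distance $i$ from $x$, let $\Gamma_3'(x)$ be the set of vertices of $\Gamma_3(x)$ having a neighbour in $\Gamma_4(x)$, and $\Gamma_3''(x):=\Gamma_3(x)\setminus\Gamma_3'(x)$. Then there is a symmetric association scheme $\mathcal X$ with $5$ classes on the vertex set of $\Gamma$, with relations $R_0,\dots,R_5$, such that $\Gamma$ is the relation graph of $R_1$ and, for every vertex $x$, the sets $\{y:(x,y)\in R_i\}$, $i=0,\dots,5$, are respectively $\{x\},\ \Gamma(x),\ \Gamma_2(x),\ \Gamma_3'(x),\ \Gamma_3''(x),\ \Gamma_4(x)$. This partition $\Pi$ is equitable, with the following data: $|\Gamma(x)|=k$, $|\Gamma_2(x)|=k(k-1)/c_2$, $|\Gamma_3'(x)|=kk_4$, $|\Gamma_3''(x)|=(k-1)b_2''/c_2$, $|\Gamma_4(x)|=k_4$; the vertex $x$ has $k$ neighbours in $\Gamma(x)$; each vertex of $\Gamma(x)$ has $1$ neighbour in $\{x\}$ and $k-1$ neighbours in $\Gamma_2(x)$;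 each vertex of $\Gamma_2(x)$ has $c_2$ neighbours in $\Gamma(x)$, $b_2'$ neighbours in $\Gamma_3'(x)$ and $b_2''$ neighbours in $\Gamma_3''(x)$; each vertex of $\Gamma_3'(x)$ has $k-1$ neighbours in $\Gamma_2(x)$ and $1$ neighbour in $\Gamma_4(x)$; each vertex of $\Gamma_3''(x)$ has $k$ neighbours in $\Gamma_2(x)$; each vertex of $\Gamma_4(x)$ has $k$ neighbours in $\Gamma_3'(x)$. In particular, $\Gamma$ is a bipartite $2$-walk-regular graph with diameter $4$ and exactly $6$ distinct eigenvalues.
   Context: A group divisible design $\mathrm{GDD}(n,m;k;\lambda_1,\lambda_2)$ is a triple $(\mathcal P,\mathcal G,\mathcal B)$ where $\mathcal P$ is a set of points, $\mathcal G$ is a partition of $\mathcal P$ into $m$ sets ("groups") each of size $n$, and $\mathcal B$ is a collection of $k$-subsets of $\mathcal P$ ("blocks") such that any two distinct points in the same group lie together in exactly $\lambda_1$ blocks and any two points in different groups lie together in exactly $\lambda_2$ blocks. The dual incidence structure has the blocks as points and the points as blocks, with the same incidence. The design has the dual property (GDDDP) if its dual is also a group divisible design with the same parameters $(n,m;k;\lambda_1,\lambda_2)$. The point-block incidence graph has vertex set $\mathcal P\cup\mathcal B$, a point being adjacent to a block iff it lies in it. A symmetric association scheme with $n$ classes on a finite set $X$ is a partition $\{R_0,\dots,R_n\}$ of $X\times X$ into nonempty relations with adjacency matrices $A_0,\dots,A_n$ such that $A_0=I$, $\sum_i A_i=J$, each $A_i$ is symmetric, and each product $A_iA_j$ is a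 linear combination of $A_0,\dots,A_n$. The relation graph of $R_i$ is the graph on $X$ with adjacency matrix $A_i$. A partition $\{P_1,\dots,P_t\}$ of the vertex set of a graph is equitable if for all $i,j$ every vertex of $P_i$ has the same number of neighbours in $P_j$. A graph is $t$-walk-regular if it has diameter at least $t$ and, for every $\ell\ge 0$, the number of walks of length $\ell$ between two vertices $x,y$ depends only on $d(x,y)$ whenever $d(x,y)\le t$.
   Formalization: The 5-class scheme and the count of 6 eigenvalues are claimed only if b_2'' ≠ 0, and empty cells are dropped from Π: when b_2'' = 0 (e.g. the 8-cycle, n=m=k=2, λ_2=1) Γ_3''(x) is empty and there are only 5 eigenvalues. *)

theory Defs
  imports "HOL-Analysis.Analysis" "HOL-Library.Extended_Nat" "HOL-Library.Disjoint_Sets"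
begin

text \<open>
  An incidence structure is a relation \<open>I\<close> between a finite type of points and a finite type of
  blocks. Blocks are labels rather than point sets, so that repeated blocks are allowed and the
  dual structure is simply \<open>I\<inverse>\<close>; the block labelled \<open>b\<close> is the point set \<open>I\<inverse> `` {b}\<close>.
\<close>

definition gdd ::
  "('p::finite \<times> 'b::finite) set \<Rightarrow> 'p set set \<Rightarrow> nat \<Rightarrow> nat \<Rightarrow> nat \<Rightarrow> nat \<Rightarrow> nat \<Rightarrow> bool" where
  "gdd I G n m k l1 l2 \<longleftrightarrow>
     partition_on UNIV G \<and> card G = m \<and> (\<forall>g\<in>G. card g = n) \<and>
     (\<forall>b. card (I\<inverse> `` {b}) = k) \<and>
     (\<forall>g\<in>G. \<forall>p\<in>g. \<forall>q\<in>g. p \<noteq> q \<longrightarrow> card {b. (p, b) \<in> I \<and> (q, b) \<in> I} = l1) \<and>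
     (\<forall>g\<in>G. \<forall>h\<in>G. g \<noteq> h \<longrightarrow> (\<forall>p\<in>g. \<forall>q\<in>h. card {b. (p, b) \<in> I \<and> (q, b) \<in> I} = l2))"

definition gdddp ::
  "('p::finite \<times> 'b::finite) set \<Rightarrow> 'p set set \<Rightarrow> nat \<Rightarrow> nat \<Rightarrow> nat \<Rightarrow> nat \<Rightarrow> nat \<Rightarrow> bool" where
  "gdddp I G n m k l1 l2 \<longleftrightarrow>
     gdd I G n m k l1 l2 \<and> (\<exists>H. gdd (I\<inverse>) H n m k l1 l2)"

text \<open>
  A graph on the vertex type \<open>'v\<close> is given by its adjacency relation \<open>E\<close>, a set of ordered pairs;
  in particular the relation graph of a symmetric relation \<open>R\<close> is \<open>R\<close> itself. The set of
  neighbours of \<open>x\<close> is \<open>E `` {x}\<close>.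
\<close>

definition incidence_graph :: "('p \<times> 'b) set \<Rightarrow> (('p + 'b) \<times> ('p + 'b)) set" where
  "incidence_graph I = {(Inl p, Inr b) | p b. (p, b) \<in> I} \<union> {(Inr b, Inl p) | p b. (p, b) \<in> I}"

definition nbrs_in :: "('v \<times> 'v) set \<Rightarrow> 'v \<Rightarrow> 'v set \<Rightarrow> nat" where
  "nbrs_in E y S = card (E `` {y} \<inter> S)"

definition walks :: "('v \<times> 'v) set \<Rightarrow> nat \<Rightarrow> 'v \<Rightarrow> 'v \<Rightarrow> 'v list set" where
  "walks E l x y = {w. length w = Suc l \<and> hd w = x \<and> last w = y \<and>
                       successively (\<lambda>u v. (u, v) \<in> E) w}"

text \<open>The infimum of the empty set in \<^typ>\<open>enat\<close> is \<open>\<infinity>\<close>, the distance of unconnected vertices.\<close>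

definition gdist :: "('v \<times> 'v) set \<Rightarrow> 'v \<Rightarrow> 'v \<Rightarrow> enat" where
  "gdist E x y = (INF l \<in> {l. walks E l x y \<noteq> {}}. enat l)"

definition gdiameter :: "('v \<times> 'v) set \<Rightarrow> enat" where
  "gdiameter E = (SUP x. SUP y. gdist E x y)"

definition gsphere :: "('v \<times> 'v) set \<Rightarrow> nat \<Rightarrow> 'v \<Rightarrow> 'v set" where
  "gsphere E i x = {y. gdist E x y = enat i}"

definition gsphere3' :: "('v \<times> 'v) set \<Rightarrow> 'v \<Rightarrow> 'v set" where
  "gsphere3' E x = {y \<in> gsphere E 3 x. E `` {y} \<inter> gsphere E 4 x \<noteq> {}}"

definition gsphere3'' :: "('v \<times> 'v) set \<Rightarrow> 'v \<Rightarrow> 'v set" where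
  "gsphere3'' E x = gsphere E 3 x - gsphere3' E x"

definition bipartite :: "('v \<times> 'v) set \<Rightarrow> bool" where
  "bipartite E \<longleftrightarrow> (\<exists>U. \<forall>(x, y) \<in> E. (x \<in> U) \<noteq> (y \<in> U))"

definition walk_regular :: "nat \<Rightarrow> ('v \<times> 'v) set \<Rightarrow> bool" where
  "walk_regular t E \<longleftrightarrow> enat t \<le> gdiameter E \<and>
     (\<forall>l x y x' y'. gdist E x y \<le> enat t \<and> gdist E x' y' = gdist E x y \<longrightarrow>
        card (walks E l x y) = card (walks E l x' y'))"

definition equitable :: "('v \<times> 'v) set \<Rightarrow> 'v set set \<Rightarrow> bool" where
  "equitable E Q \<longleftrightarrow> partition_on UNIV Q \<and>
     (\<forall>A\<in>Q. \<forall>B\<in>Q. \<forall>y\<in>A. \<forall>z\<in>A. nbrs_in E y B = nbrs_in E z B)"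

definition adj_matrix :: "('v::finite \<times> 'v) set \<Rightarrow> real^'v^'v" where
  "adj_matrix E = (\<chi> x y. if (x, y) \<in> E then 1 else 0)"

definition eigenvalues :: "real^'v^'v::finite \<Rightarrow> real set" where
  "eigenvalues A = {\<mu>. \<exists>v. v \<noteq> 0 \<and> A *v v = \<mu> *\<^sub>R v}"

definition symmetric_assoc_scheme :: "nat \<Rightarrow> (nat \<Rightarrow> ('v::finite \<times> 'v) set) \<Rightarrow> bool" where
  "symmetric_assoc_scheme d R \<longleftrightarrow>
     (\<forall>i\<le>d. R i \<noteq> {}) \<and> disjoint_family_on R {..d} \<and> (\<Union>i\<le>d. R i) = UNIV \<and>
     adj_matrix (R 0) = mat 1 \<and>
     (\<Sum>i\<le>d. adj_matrix (R i)) = (\<chi> x y. 1) \<and>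
     (\<forall>i\<le>d. transpose (adj_matrix (R i)) = adj_matrix (R i)) \<and>
     (\<forall>i\<le>d. \<forall>j\<le>d. adj_matrix (R i) ** adj_matrix (R j)
        \<in> span ((\<lambda>h. adj_matrix (R h)) ` {..d}))"

end

theory Submission
  imports Defs
begin

text \<open>
  Put points and blocks on an equal footing: on \<open>'p + 'b\<close> let \<open>A\<close> be the adjacency matrix, \<open>K\<close>
  the indicator of ``same group'', \<open>S\<close> of ``same side'' and \<open>T\<close> of ``opposite sides''. The design
  axioms and their duals say exactly \<open>A\<^sup>2 = k I + \<lambda>\<^sub>2 (S - K)\<close>. Since \<open>A\<close> commutes with \<open>A\<^sup>2\<close> and
  with \<open>S\<close>, it commutes with \<open>K\<close>: a point lies on a block of the group of \<open>b\<close> iff \<open>b\<close> meets the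
  group of the point. Hence \<open>I, K, S, A, K A, T\<close> span a commutative algebra, and the six relations
  have the adjacency matrices \<open>I, A, S - K, K A - A, T - K A, K - I\<close>. All cardinalities and
  neighbour counts are entries of products in this algebra; walk-regularity holds because the powers
  of \<open>A\<close> are constant on the relations. The eigenvalues are \<open>\<plusminus>k\<close>, \<open>\<plusminus>\<surd>k\<close> and \<open>\<plusminus>\<surd>(k - n \<lambda>\<^sub>2)\<close>.
\<close>

section \<open>Walks, distances and adjacency matrices\<close>

lemma finite_walks: "finite (walks E l x (y::'v::finite))"
  by (rule finite_subset[OF _ finite_lists_length_eq[of UNIV "Suc l"]]) (auto simp: walks_def)

lemma walks_0: "walks E 0 x y = (if x = y then {[x]} else {})"
  by (auto simp: walks_def length_Suc_conv)

lemma walks_Suc: "walks E (Suc l) x y = (\<Union>z\<in>E `` {x}. (#) x ` walks E l z y)"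
proof (intro equalityI subsetI)
  fix w assume "w \<in> walks E (Suc l) x y"
  then obtain z u where "w = x # z # u" "length u = l" "last (z # u) = y" "(x, z) \<in> E"
    "successively (\<lambda>u v. (u, v) \<in> E) (z # u)"
    by (auto simp: walks_def length_Suc_conv)
  then show "w \<in> (\<Union>z\<in>E `` {x}. (#) x ` walks E l z y)"
    by (auto simp: walks_def intro!: bexI[of _ z])
qed (auto simp: walks_def successively_Cons)

text \<open>Existence of walks reduces to relational powers, whose composition laws give the
  distances later on.\<close>

lemma walks_nonempty_iff_relpow: "walks E l x y \<noteq> {} \<longleftrightarrow> (x, y) \<in> E ^^ l"
proof (induction l arbitrary: x)
  case (Suc l)
  then show ?case
    by (auto simp: walks_Suc simp del: relpow.simps intro: relpow_Suc_I2 dest: relpow_Suc_D2)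
qed (simp add: walks_0)

lemma gdist_eqI:
  assumes "(x, y) \<in> E ^^ i" "\<And>j. j < i \<Longrightarrow> (x, y) \<notin> E ^^ j"
  shows "gdist E x y = enat i"
  unfolding gdist_def
proof (rule antisym)
  show "(INF l\<in>{l. walks E l x y \<noteq> {}}. enat l) \<le> enat i"
    using assms(1) by (intro INF_lower) (simp add: walks_nonempty_iff_relpow)
  show "enat i \<le> (INF l\<in>{l. walks E l x y \<noteq> {}}. enat l)"
    using assms(2) by (intro INF_greatest) (force simp: walks_nonempty_iff_relpow not_less[symmetric])
qed

lemma adj_matrix_nth [simp]: "adj_matrix X $ x $ y = (if (x, y) \<in> X then 1 else 0)"
  by (simp add: adj_matrix_def)

lemma adj_matrix_mult_nth:
  "(adj_matrix X ** adj_matrix Y) $ x $ y = real (card {z. (x, z) \<in> X \<and> (z, y) \<in> Y})"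
proof -
  have "(adj_matrix X ** adj_matrix Y) $ x $ y
      = (\<Sum>z\<in>UNIV. if (x, z) \<in> X \<and> (z, y) \<in> Y then 1 else 0)"
    unfolding matrix_matrix_mult_def by (auto intro!: sum.cong)
  then show ?thesis by (simp add: sum.If_cases)
qed

text \<open>Splitting a walk at its second vertex is one left multiplication by the adjacency
  matrix, so the power takes the form of an iterated left multiplication starting from
  \<open>mat 1\<close>.\<close>

lemma card_walks_eq_matrix_power:
  "real (card (walks E l x y)) = (((**) (adj_matrix E) ^^ l) (mat 1)) $ x $ y"
proof (induction l arbitrary: x)
  case 0
  then show ?case by (simp add: walks_0 mat_def)
next
  case (Suc l)
  have "card (walks E (Suc l) x y) = (\<Sum>z\<in>E `` {x}. card ((#) x ` walks E l z y))"
    unfolding walks_Suc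
    \<comment> \<open>Pieces for different \<open>z\<close> are disjoint, since the tail of each
      walk has \<open>z\<close> as its head.\<close>
    by (rule card_UN_disjoint) (auto simp: finite_walks, auto simp: walks_def)
  also have "\<dots> = (\<Sum>z\<in>E `` {x}. card (walks E l z y))"
    by (simp add: card_image)
  finally have "real (card (walks E (Suc l) x y))
      = (\<Sum>z\<in>E `` {x}. (((**) (adj_matrix E) ^^ l) (mat 1)) $ z $ y)"
    by (simp add: Suc)
  also have "\<dots> = (\<Sum>z\<in>UNIV. if z \<in> E `` {x} then (((**) (adj_matrix E) ^^ l) (mat 1)) $ z $ y else 0)"
    by (simp only: sum.If_cases finite Collect_mem_eq Int_UNIV_left) simp
  also have "\<dots> = (((**) (adj_matrix E) ^^ Suc l) (mat 1)) $ x $ y"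
    by (auto simp: matrix_matrix_mult_def intro!: sum.cong)
  finally show ?case .
qed

section \<open>Bilinearity of the matrix product and its effect on spans\<close>

lemma linear_matrix_mult_left: "linear (\<lambda>X::real^'n^'m. X ** (B::real^'p^'n))"
  by (rule linearI)
    (simp_all add: vec_eq_iff matrix_matrix_mult_def algebra_simps sum.distrib sum_distrib_left)

lemma linear_matrix_mult_right: "linear (\<lambda>X::real^'p^'n. (B::real^'n^'m) ** X)"
  by (rule linearI)
    (simp_all add: vec_eq_iff matrix_matrix_mult_def algebra_simps sum.distrib sum_distrib_left)

lemmas matrix_mult_linear_simps =
  linear_add[OF linear_matrix_mult_left] linear_diff[OF linear_matrix_mult_left]
  linear_cmul[OF linear_matrix_mult_left]
  linear_add[OF linear_matrix_mult_right] linear_diff[OF linear_matrix_mult_right]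
  linear_cmul[OF linear_matrix_mult_right]

text \<open>By bilinearity, closure need only be checked on generators. The first induction expands
  the left factor against a fixed generator, the second expands the right factor.\<close>

lemma span_matrix_mult_closed:
  fixes X Y :: "(real^'n^'n::finite) set"
  assumes "\<And>a b. a \<in> X \<Longrightarrow> b \<in> Y \<Longrightarrow> a ** b \<in> span Z"
    and "a \<in> span X" "b \<in> span Y"
  shows "a ** b \<in> span Z"
proof -
  have *: "a ** b \<in> span Z" if "b \<in> Y" for b
    using assms(2)
  proof (induction a rule: span_induct_alt)
    case base
    then show ?case by (simp add: span_zero)
  next
    case (step c x y)
    then show ?case
      using assms(1)[OF step(1) that]
      by (simp add: matrix_mult_linear_simps span_add span_scale)
  qed
  show ?thesis
    using assms(3)
  proof (induction b rule: span_induct_alt)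
    case base
    then show ?case by (simp add: span_zero)
  next
    case (step c x y)
    then show ?case
      using *[OF step(1)]
      by (simp add: matrix_mult_linear_simps span_add span_scale)
  qed
qed

lemma transpose_scaleR_real: "transpose (c *\<^sub>R (X::real^'n^'m)) = c *\<^sub>R transpose X"
  by (simp add: vec_eq_iff transpose_def)

section \<open>The adjacency algebra\<close>

text \<open>Here \<open>s\<close> tells points from blocks, and \<open>Q\<close> relates vertices of the same (dual) group.\<close>

locale divisible_incidence_graph =
  fixes E :: "('v::finite \<times> 'v) set" and s :: "'v \<Rightarrow> bool" and Q :: "'v \<Rightarrow> 'v \<Rightarrow> bool"
    and n m k l2 :: nat
  assumes edge_sym: "(x, y) \<in> E \<Longrightarrow> (y, x) \<in> E"
    and edge_side: "(x, y) \<in> E \<Longrightarrow> s x \<noteq> s y"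
    and Q_refl [simp]: "Q x x"
    and Q_sym: "Q x y \<Longrightarrow> Q y x"
    and Q_trans: "Q x y \<Longrightarrow> Q y z \<Longrightarrow> Q x z"
    and Q_side: "Q x y \<Longrightarrow> s x = s y"
    and card_Q: "card {y. Q x y} = n"
    and card_side: "card {y. s y = t} = m * n"
    and degree: "card (E `` {x}) = k"
    and no_common: "Q x y \<Longrightarrow> x \<noteq> y \<Longrightarrow> (x, z) \<in> E \<Longrightarrow> (y, z) \<notin> E"
    and common: "s x = s y \<Longrightarrow> \<not> Q x y \<Longrightarrow> card (E `` {x} \<inter> E `` {y}) = l2"
    and n_ge: "n \<ge> 2" and m_ge: "m \<ge> 2" and l2_ge: "l2 \<ge> 1"
begin

lemma Q_commute: "Q x y = Q y x"
  using Q_sym by blast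

lemma Q_unique: "Q x y \<Longrightarrow> (x, z) \<in> E \<Longrightarrow> (y, z) \<in> E \<Longrightarrow> x = y"
  using no_common by blast

lemma edge_commute: "(x, y) \<in> E \<longleftrightarrow> (y, x) \<in> E"
  using edge_sym by blast

definition A where "A = adj_matrix E"
definition K where "K = adj_matrix {(x, y). Q x y}"
definition S where "S = adj_matrix {(x, y). s x = s y}"
definition T where "T = adj_matrix {(x, y). s x \<noteq> s y}"

lemmas mat_defs = A_def K_def S_def T_def

section \<open>Pairwise products of the generating matrices\<close>

lemma AA: "A ** A = real k *\<^sub>R mat 1 + real l2 *\<^sub>R (S - K)"
proof -
  \<comment> \<open>The values come from the degree, from \<open>common\<close> and from
    \<open>no_common\<close>; vertices on opposite sides have no common neighbour because edges
    change sides.\<close>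
  have "card {z. (x, z) \<in> E \<and> (z, y) \<in> E} = (if x = y then k else if s x = s y \<and> \<not> Q x y then l2 else 0)"
    for x y
  proof -
    have eq: "{z. (x, z) \<in> E \<and> (z, y) \<in> E} = E `` {x} \<inter> E `` {y}"
      using edge_commute by auto
    show ?thesis
    proof (cases "s x = s y")
      case False
      then have "E `` {x} \<inter> E `` {y} = {}" using edge_side by fastforce
      then show ?thesis using False eq by auto
    next
      case True
      have "E `` {x} \<inter> E `` {y} = {}" if "Q x y" "x \<noteq> y"
        using no_common[OF that] by auto
      then show ?thesis using True eq degree common by auto
    qed
  qed
  then show ?thesis
    unfolding mat_defs vec_eq_iff adj_matrix_mult_nth
    by (auto simp: mat_def Q_side)
qed

lemma KK: "K ** K = real n *\<^sub>R K"
proof -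
  have "{z. Q x z \<and> Q z y} = (if Q x y then {z. Q x z} else {})" for x y
    by (cases "Q x y") (simp_all, (blast intro: Q_sym Q_trans)+)
  then show ?thesis
    unfolding mat_defs vec_eq_iff adj_matrix_mult_nth by (auto simp: card_Q)
qed

lemma KS: "K ** S = real n *\<^sub>R S"
proof -
  have "{z. Q x z \<and> s z = s y} = (if s x = s y then {z. Q x z} else {})" for x y
    using Q_side by auto
  then show ?thesis
    unfolding mat_defs vec_eq_iff adj_matrix_mult_nth by (auto simp: card_Q)
qed

lemma KT: "K ** T = real n *\<^sub>R T"
proof -
  have "{z. Q x z \<and> s z \<noteq> s y} = (if s x \<noteq> s y then {z. Q x z} else {})" for x y
    using Q_side by auto
  then show ?thesis
    unfolding mat_defs vec_eq_iff adj_matrix_mult_nth by (auto simp: card_Q)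
qed

lemma AS: "A ** S = real k *\<^sub>R T"
proof -
  have "{z. (x, z) \<in> E \<and> s z = s y} = (if s x \<noteq> s y then E `` {x} else {})" for x y
    using edge_side by auto
  then show ?thesis
    unfolding mat_defs vec_eq_iff adj_matrix_mult_nth by (auto simp: degree)
qed

lemma AT: "A ** T = real k *\<^sub>R S"
proof -
  have "{z. (x, z) \<in> E \<and> s z \<noteq> s y} = (if s x = s y then E `` {x} else {})" for x y
    using edge_side by auto
  then show ?thesis
    unfolding mat_defs vec_eq_iff adj_matrix_mult_nth by (auto simp: degree)
qed

lemma SS: "S ** S = real (m * n) *\<^sub>R S"
proof -
  have "{z. s x = s z \<and> s z = s y} = (if s x = s y then {z. s z = s x} else {})" for x y
    by auto
  then show ?thesis
    unfolding mat_defs vec_eq_iff adj_matrix_mult_nth by (auto simp: card_side)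
qed

lemma ST: "S ** T = real (m * n) *\<^sub>R T"
proof -
  have "{z. s x = s z \<and> s z \<noteq> s y} = (if s x \<noteq> s y then {z. s z = s x} else {})" for x y
    by auto
  then show ?thesis
    unfolding mat_defs vec_eq_iff adj_matrix_mult_nth by (auto simp: card_side)
qed

lemma TT: "T ** T = real (m * n) *\<^sub>R S"
proof -
  have "{z. s x \<noteq> s z \<and> s z \<noteq> s y} = (if s x = s y then {z. s z \<noteq> s x} else {})" for x y
    by auto
  then show ?thesis
    unfolding mat_defs vec_eq_iff adj_matrix_mult_nth using card_side[of True] card_side[of False]
    by auto
qed

lemma transposes: "transpose A = A" "transpose K = K" "transpose S = S" "transpose T = T"
  by (auto simp: mat_defs vec_eq_iff transpose_def edge_commute Q_commute intro: Q_sym edge_sym)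

text \<open>These are transposes of earlier products; all factors are symmetric, so transposing only
  reverses their order.\<close>

lemma SK: "S ** K = real n *\<^sub>R S" and TK: "T ** K = real n *\<^sub>R T"
  and SA: "S ** A = real k *\<^sub>R T" and TA: "T ** A = real k *\<^sub>R S"
  and TS: "T ** S = real (m * n) *\<^sub>R T"
  using arg_cong[OF KS, of transpose] arg_cong[OF KT, of transpose] arg_cong[OF AS, of transpose]
    arg_cong[OF AT, of transpose] arg_cong[OF ST, of transpose]
  by (simp_all add: matrix_transpose_mul transposes transpose_scaleR_real del: of_nat_mult)

text \<open>Compute \<open>A\<^sup>3\<close> in two ways.\<close>

lemma AK: "A ** K = K ** A"
proof -
  have "A ** (A ** A) = (A ** A) ** A" by (simp add: matrix_mul_assoc)
  then have "real l2 *\<^sub>R (A ** K) = real l2 *\<^sub>R (K ** A)"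
    by (simp add: AA matrix_mult_linear_simps AS SA scaleR_diff_right)
  then show ?thesis using l2_ge by simp
qed

lemma A_KA: "A ** (K ** A) = K ** (A ** A)"
  using AK by (simp add: matrix_mul_assoc)

section \<open>The span of the six generators is closed under multiplication\<close>

definition basis where "basis = {mat 1, K, S, A, K ** A, T}"

text \<open>The multiplication table. Commutation moves \<open>K\<close> past \<open>A\<close>, so
  that every product reduces to the products of \<open>A\<close>, \<open>K\<close>, \<open>S\<close>
  and \<open>T\<close> already computed.\<close>

lemma basis_mult_closed: "a \<in> basis \<Longrightarrow> b \<in> basis \<Longrightarrow> a ** b \<in> span basis"
proof -
  have b: "mat 1 \<in> span basis" "K \<in> span basis" "S \<in> span basis" "A \<in> span basis" "K ** A \<in> span basis"
    "T \<in> span basis"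
    by (auto simp: basis_def intro: span_base)
  have K_KA: "K ** (K ** A) = real n *\<^sub>R (K ** A)"
    by (simp add: matrix_mul_assoc KK matrix_mult_linear_simps)
  have KAA: "K ** (A ** A) \<in> span basis"
    unfolding AA by (simp add: matrix_mult_linear_simps KS KK b span_add span_diff span_scale scaleR_diff_right)
  have KA_A: "(K ** A) ** A = K ** (A ** A)" and KA_K: "(K ** A) ** K = K ** (K ** A)"
    and KA_S: "(K ** A) ** S = K ** (A ** S)" and KA_T: "(K ** A) ** T = K ** (A ** T)"
    by (simp_all add: matrix_mul_assoc[symmetric] AK)
  have S_KA: "S ** (K ** A) = (S ** K) ** A" and T_KA: "T ** (K ** A) = (T ** K) ** A"
    by (simp_all add: matrix_mul_assoc)
  have KA_KA: "(K ** A) ** (K ** A) = real n *\<^sub>R (K ** (A ** A))"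
    using K_KA KK by (metis A_KA matrix_mul_assoc linear_cmul[OF linear_matrix_mult_left])
  have AA': "A ** A \<in> span basis"
    unfolding AA by (simp add: b span_add span_diff span_scale)
  have "a ** b \<in> span basis" if "a \<in> {mat 1, K, S, A, K ** A, T}" "b \<in> {mat 1, K, S, A, K ** A, T}" for a b
    using that
    by (auto simp: K_KA KA_A KA_K KA_S KA_T KA_KA S_KA T_KA A_KA KK KS KT SS ST TT AS AT SA TA SK TK TS AK
        matrix_mult_linear_simps b KAA AA' intro!: span_scale simp del: of_nat_mult)
  then show "a \<in> basis \<Longrightarrow> b \<in> basis \<Longrightarrow> a ** b \<in> span basis"
    by (simp only: basis_def[symmetric])
qed

lemma span_basis_mult: "a \<in> span basis \<Longrightarrow> b \<in> span basis \<Longrightarrow> a ** b \<in> span basis"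
  by (rule span_matrix_mult_closed[OF basis_mult_closed])

text \<open>Evaluating \<open>A ** A ** S\<close> in two ways is the double count k(k-1) = l2 (mn -
  n) of the paths of length two from a fixed vertex to other vertices.\<close>

lemma kk: "real k * real k = real k + real l2 * (real m * real n - real n)"
proof -
  have "(A ** A) ** S = A ** (A ** S)" by (simp add: matrix_mul_assoc)
  then have "(real k + real l2 * (real m * real n - real n)) *\<^sub>R S = (real k * real k) *\<^sub>R S"
    by (simp add: AA matrix_mult_linear_simps AS AT SS KS scaleR_diff_left scaleR_add_left right_diff_distrib scaleR_diff_right)
  moreover have "S \<noteq> 0"
    by (auto simp: S_def vec_eq_iff)
  ultimately show ?thesis by simp
qed

section \<open>The six relations and their adjacency matrices\<close>

definition rel :: "nat \<Rightarrow> ('v \<times> 'v) set" where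
  "rel i = [Id, E, {(x, y). s x = s y \<and> \<not> Q x y},
     {(x, y). (x, y) \<notin> E \<and> (\<exists>z. Q x z \<and> (z, y) \<in> E)},
     {(x, y). s x \<noteq> s y \<and> \<not> (\<exists>z. Q x z \<and> (z, y) \<in> E)},
     {(x, y). Q x y \<and> x \<noteq> y}] ! i"

lemma rel_simps [simp]:
  "rel 0 = Id" "rel (Suc 0) = E" "rel 2 = {(x, y). s x = s y \<and> \<not> Q x y}"
  "rel 3 = {(x, y). (x, y) \<notin> E \<and> (\<exists>z. Q x z \<and> (z, y) \<in> E)}"
  "rel 4 = {(x, y). s x \<noteq> s y \<and> \<not> (\<exists>z. Q x z \<and> (z, y) \<in> E)}"
  "rel 5 = {(x, y). Q x y \<and> x \<noteq> y}"
  by (simp_all add: rel_def numeral_eq_Suc)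

lemma atMost_5: "{..5::nat} = {0, Suc 0, 2, 3, 4, 5}"
  by auto

text \<open>At most one edge joins a group to a given vertex, because two group mates have no common
  neighbour. Hence the product counts 0 or 1 and is itself an adjacency matrix.\<close>

lemma KA_nth: "(K ** A) $ x $ y = (if \<exists>z. Q x z \<and> (z, y) \<in> E then 1 else 0)"
proof (cases "\<exists>z. Q x z \<and> (z, y) \<in> E")
  case True
  then obtain z where "Q x z" "(z, y) \<in> E" by blast
  then have "{z. Q x z \<and> (z, y) \<in> E} = {z}"
    using Q_unique Q_sym Q_trans by blast
  then show ?thesis using True by (simp add: mat_defs adj_matrix_mult_nth)
qed (auto simp: mat_defs adj_matrix_mult_nth)

text \<open>The relations are phrased through \<open>Q\<close> and \<open>E\<close> so that each
  matrix is a generator or a difference of two nested 0/1 generators: entrywise \<open>mat 1\<close>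
  lies below \<open>K\<close>, \<open>K\<close> below \<open>S\<close>, \<open>A\<close> below
  \<open>K ** A\<close>, and \<open>K ** A\<close> below \<open>T\<close>. The description by
  distances is recovered in \<open>gdist_eq_iff\<close> and \<open>gsphere3'_rel\<close>.\<close>

lemma adj_rel:
  "adj_matrix (rel 0) = mat 1" "adj_matrix (rel (Suc 0)) = A" "adj_matrix (rel 2) = S - K"
  "adj_matrix (rel 3) = K ** A - A" "adj_matrix (rel 4) = T - K ** A" "adj_matrix (rel 5) = K - mat 1"
proof -
  have side: "s x \<noteq> s y" if "Q x z" "(z, y) \<in> E" for x y z
    using that edge_side Q_side by metis
  show "adj_matrix (rel 0) = mat 1" "adj_matrix (rel (Suc 0)) = A" "adj_matrix (rel 2) = S - K"
    "adj_matrix (rel 5) = K - mat 1"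
    using Q_side by (auto simp: mat_defs vec_eq_iff mat_def)
  show "adj_matrix (rel 3) = K ** A - A"
    unfolding vec_eq_iff vector_minus_component KA_nth
    by (auto simp: A_def)
  show "adj_matrix (rel 4) = T - K ** A"
    unfolding vec_eq_iff vector_minus_component KA_nth
    using side by (auto simp: T_def)
qed

abbreviation rel_span where "rel_span \<equiv> span ((\<lambda>h. adj_matrix (rel h)) ` {..5})"

lemma adj_rel_in_span_basis: "i \<le> 5 \<Longrightarrow> adj_matrix (rel i) \<in> span basis"
proof -
  assume "i \<le> 5"
  then have "i \<in> {0, Suc 0, 2, 3, 4, 5}" using atMost_5 by auto
  then show ?thesis
    by (auto simp: adj_rel simp del: rel_simps intro!: span_diff intro: span_base simp: basis_def)
qed

text \<open>The change of generators is triangular: adding back \<open>mat 1\<close>,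
  \<open>K\<close>, \<open>A\<close> and \<open>K ** A\<close> in turn recovers \<open>K\<close>,
  \<open>S\<close>, \<open>K ** A\<close> and \<open>T\<close>.\<close>

lemma span_basis_subset: "span basis \<subseteq> rel_span"
proof -
  have base: "adj_matrix (rel i) \<in> rel_span" if "i \<in> {..5}" for i
    using that by (intro span_base imageI)
  have r: "mat 1 \<in> rel_span" "A \<in> rel_span" "S - K \<in> rel_span" "K ** A - A \<in> rel_span"
    "T - K ** A \<in> rel_span" "K - mat 1 \<in> rel_span"
    using base[of 0] base[of "Suc 0"] base[of 2] base[of 3] base[of 4] base[of 5]
    by (simp_all add: adj_rel del: rel_simps)
  have K: "K \<in> rel_span" using span_add[OF r(6) r(1)] by simp
  have S: "S \<in> rel_span" using span_add[OF r(3) K] by simp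
  have KA: "K ** A \<in> rel_span" using span_add[OF r(4) r(2)] by simp
  have T: "T \<in> rel_span" using span_add[OF r(5) KA] by simp
  have "basis \<subseteq> rel_span" using r K S KA T by (auto simp: basis_def)
  then show ?thesis by (simp add: span_minimal)
qed

text \<open>For \<open>rel 3\<close> and \<open>rel 4\<close> symmetry is not visible from the
  definition: it is the commutation \<open>AK\<close>, which makes \<open>K ** A\<close>
  symmetric.\<close>

lemma rel_sym: "i \<le> 5 \<Longrightarrow> transpose (adj_matrix (rel i)) = adj_matrix (rel i)"
proof -
  assume "i \<le> 5"
  then have "i \<in> {0, Suc 0, 2, 3, 4, 5}" using atMost_5 by auto
  moreover have "transpose (X - Y) = transpose X - transpose Y" for X Y :: "real^'v^'v"
    by (simp add: vec_eq_iff transpose_def)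
  ultimately show ?thesis
    by (auto simp: adj_rel transposes matrix_transpose_mul AK transpose_mat simp del: rel_simps)
qed

lemma rel_cover: "\<exists>i\<in>{..5}. (x, y) \<in> rel i"
  unfolding atMost_5 by auto

text \<open>Relations 1, 3, 4 join opposite sides while 0, 2, 5 stay on one side; only relations of
  the same kind remain to be separated.\<close>

lemma rel_disjoint: "disjoint_family_on rel {..5}"
proof -
  have "s x \<noteq> s y" if "(x, y) \<in> rel (Suc 0) \<union> rel 3 \<union> rel 4" for x y
    using that edge_side Q_side by (auto; metis)
  moreover have "s x = s y" if "(x, y) \<in> rel 0 \<union> rel 2 \<union> rel 5" for x y
    using that Q_side by auto
  ultimately have "(rel (Suc 0) \<union> rel 3 \<union> rel 4) \<inter> (rel 0 \<union> rel 2 \<union> rel 5) = {}"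
    by (simp only: disjoint_iff split_paired_All) blast
  moreover have "rel 0 \<inter> rel 2 = {}" "rel 0 \<inter> rel 5 = {}" "rel 2 \<inter> rel 5 = {}"
    "rel (Suc 0) \<inter> rel 3 = {}" "rel (Suc 0) \<inter> rel 4 = {}" "rel 3 \<inter> rel 4 = {}"
    by auto
  ultimately show ?thesis
    unfolding atMost_5 disjoint_family_on_def by (simp del: rel_simps) blast
qed

text \<open>By disjointness each adjacency matrix is constant on every relation, and this passes to
  linear combinations. Both walk-regularity and equitability rest on it.\<close>

lemma matrix_in_span_const:
  assumes "M \<in> span basis" "i \<le> 5" "(x, y) \<in> rel i" "(x', y') \<in> rel i"
  shows "M $ x $ y = M $ x' $ y'"
proof -
  have "M \<in> rel_span" using assms(1) span_basis_subset by blast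
  then show ?thesis
  proof (induction M rule: span_induct_alt)
    case (step c X Y)
    then obtain h where h: "h \<le> 5" "X = adj_matrix (rel h)" by auto
    then have "(x, y) \<in> rel h \<longleftrightarrow> (x', y') \<in> rel h"
      using assms(2-4) rel_disjoint unfolding disjoint_family_on_def by (metis IntI atMost_iff empty_iff)
    then show ?case using step h by simp
  qed simp
qed


subsection \<open>Distances and neighbour counts\<close>

lemma ex_other_group: "\<exists>y. s y = s x \<and> \<not> Q x y"
proof (rule ccontr)
  assume "\<nexists>y. s y = s x \<and> \<not> Q x y"
  then have "{y. s y = s x} = {y. Q x y}" using Q_side by auto
  then have "m * n = n" using card_side card_Q by metis
  then show False using n_ge m_ge by simp
qed

lemma ex_group_mate: "\<exists>y. Q x y \<and> x \<noteq> y"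
proof (rule ccontr)
  assume "\<nexists>y. Q x y \<and> x \<noteq> y"
  then have "{y. Q x y} = {x}" by auto
  then show False using card_Q[of x] n_ge by simp
qed

lemma common_nbr: "s x = s y \<Longrightarrow> \<not> Q x y \<Longrightarrow> \<exists>z. (x, z) \<in> E \<and> (z, y) \<in> E"
proof -
  assume "s x = s y" "\<not> Q x y"
  then have "card (E `` {x} \<inter> E `` {y}) \<noteq> 0" using common l2_ge by simp
  then have "E `` {x} \<inter> E `` {y} \<noteq> {}" by (metis card.empty)
  then show ?thesis using edge_sym by blast
qed

text \<open>Two vertices on one side in different groups have a common neighbour, whose degree is
  therefore at least two; all degrees equal \<open>k\<close>.\<close>

lemma k_ge: "k \<ge> 2"
proof -
  fix x
  obtain y where "s y = s x" "\<not> Q x y" using ex_other_group by blast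
  then obtain z where "(x, z) \<in> E" "(z, y) \<in> E" using common_nbr by metis
  then have "{x, y} \<subseteq> E `` {z}" using edge_sym by blast
  then have "card {x, y} \<le> k" using degree[of z] by (metis card_mono finite)
  moreover have "x \<noteq> y" using \<open>\<not> Q x y\<close> by auto
  ultimately show ?thesis by simp
qed

text \<open>Every edge changes sides, so the endpoints determine the parity of a walk. This excludes
  the shorter lengths of wrong parity in the distance computations.\<close>

lemma relpow_side: "(x, y) \<in> E ^^ j \<Longrightarrow> s x = s y \<longleftrightarrow> even j"
proof (induction j arbitrary: y)
  case (Suc j)
  then obtain z where z: "(x, z) \<in> E ^^ j" "(z, y) \<in> E" by auto
  show ?case using Suc.IH[OF z(1)] edge_side[OF z(2)] by auto
qed simp

lemma rel_side:
  "(x, y) \<in> rel 0 \<or> (x, y) \<in> rel 2 \<or> (x, y) \<in> rel 5 \<Longrightarrow> s x = s y"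
  "(x, y) \<in> rel (Suc 0) \<or> (x, y) \<in> rel 3 \<or> (x, y) \<in> rel 4 \<Longrightarrow> s x \<noteq> s y"
proof -
  show "(x, y) \<in> rel 0 \<or> (x, y) \<in> rel 2 \<or> (x, y) \<in> rel 5 \<Longrightarrow> s x = s y"
    using Q_side by auto
  have "s x \<noteq> s y" if "Q x z" "(z, y) \<in> E" for z
    using Q_side[OF that(1)] edge_side[OF that(2)] by simp
  then show "(x, y) \<in> rel (Suc 0) \<or> (x, y) \<in> rel 3 \<or> (x, y) \<in> rel 4 \<Longrightarrow> s x \<noteq> s y"
    using edge_side by auto
qed

lemma relpow_2_iff: "(x, y) \<in> E ^^ 2 \<longleftrightarrow> (\<exists>z. (x, z) \<in> E \<and> (z, y) \<in> E)"
  by (auto simp: numeral_2_eq_2)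

lemma relpow_2: "(x, y) \<in> rel 2 \<Longrightarrow> (x, y) \<in> E ^^ 2"
  using common_nbr[of x y] by (simp add: relpow_2_iff)

lemma gdist_rel_0: "(x, y) \<in> rel 0 \<Longrightarrow> gdist E x y = enat 0"
  by (rule gdist_eqI) auto

lemma gdist_rel_1: "(x, y) \<in> rel (Suc 0) \<Longrightarrow> gdist E x y = enat 1"
  by (rule gdist_eqI) (use edge_side in auto)

lemma gdist_rel_2:
  assumes "(x, y) \<in> rel 2" shows "gdist E x y = enat 2"
proof (rule gdist_eqI[OF relpow_2[OF assms]])
  fix j :: nat assume j: "j < 2"
  show "(x, y) \<notin> E ^^ j"
  proof
    assume h: "(x, y) \<in> E ^^ j"
    then have "even j" using relpow_side rel_side(1) assms by blast
    then have "j = 0" using j by presburger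
    then show False using h assms by auto
  qed
qed

lemma gdist_rel_3_4:
  assumes "(x, y) \<in> rel 3 \<or> (x, y) \<in> rel 4" shows "gdist E x y = enat 3"
proof (rule gdist_eqI)
  have side: "s x \<noteq> s y" using assms rel_side(2) by blast
  have nE: "(x, y) \<notin> E" using assms by auto
  \<comment> \<open>Some neighbour of \<open>y\<close> lies outside the group of \<open>x\<close>:
    two neighbours inside it would be group mates sharing \<open>y\<close>, yet \<open>y\<close> has
    at least two neighbours. That neighbour is reached from \<open>x\<close> in two steps.\<close>
  have "\<exists>z\<in>E `` {y}. \<not> Q x z"
  proof (rule ccontr)
    assume *: "\<not> ?thesis"
    have "z = z'" if z: "z \<in> E `` {y}" "z' \<in> E `` {y}" for z z'
    proof -
      have "Q x z" "Q x z'" using z * by auto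
      then have "Q z z'" by (blast intro: Q_sym Q_trans)
      then show ?thesis using Q_unique z edge_sym by blast
    qed
    then have "card (E `` {y}) \<le> 1" by (simp add: card_le_Suc0_iff_eq)
    then show False using degree[of y] k_ge by simp
  qed
  then obtain z where z: "(y, z) \<in> E" "\<not> Q x z" by auto
  then have "(x, z) \<in> rel 2" using side edge_side[OF z(1)] by auto
  then have "(x, y) \<in> E ^^ Suc 2"
    using relpow_2 edge_sym[OF z(1)] by (rule_tac relpow_Suc_I)
  then show "(x, y) \<in> E ^^ 3" by simp
  fix j :: nat assume j: "j < 3"
  show "(x, y) \<notin> E ^^ j"
  proof
    assume h: "(x, y) \<in> E ^^ j"
    then have "odd j" using relpow_side side by blast
    then have "j = 1" using j by presburger
    then show False using h nE by auto
  qed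
qed

text \<open>A walk of length 4 detours through a vertex of another group on the same side, two steps
  each way; length 2 is impossible because group mates have no common neighbour.\<close>

lemma gdist_rel_5:
  assumes "(x, y) \<in> rel 5" shows "gdist E x y = enat 4"
proof (rule gdist_eqI)
  have Q: "Q x y" "x \<noteq> y" using assms by auto
  obtain z where z: "s z = s x" "\<not> Q x z" using ex_other_group by blast
  moreover have "\<not> Q z y" using z(2) Q(1) by (blast intro: Q_sym Q_trans)
  ultimately have "(x, z) \<in> rel 2" "(z, y) \<in> rel 2"
    using Q_side[OF Q(1)] by auto
  then have "(x, y) \<in> E ^^ (2 + 2)"
    unfolding relpow_add using relpow_2 by blast
  then show "(x, y) \<in> E ^^ 4" by simp
  fix j :: nat assume j: "j < 4"
  show "(x, y) \<notin> E ^^ j"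
  proof
    assume h: "(x, y) \<in> E ^^ j"
    then have "even j" using relpow_side Q_side Q by blast
    then have "j = 0 \<or> j = 2" using j by presburger
    then show False
      using h Q no_common[OF Q] edge_sym by (elim disjE) (simp, use relpow_2_iff in blast)
  qed
qed

lemmas gdist_rel = gdist_rel_0 gdist_rel_1 gdist_rel_2 gdist_rel_3_4 gdist_rel_5

lemma rel_cases:
  obtains "(x, y) \<in> rel 0" | "(x, y) \<in> rel (Suc 0)" | "(x, y) \<in> rel 2"
    | "(x, y) \<in> rel 3" | "(x, y) \<in> rel 4" | "(x, y) \<in> rel 5"
  using rel_cover[of x y] unfolding atMost_5 by blast

text \<open>Each relation forces one distance and the relations exhaust all pairs, so the
  implications reverse.\<close>

lemma gdist_eq_iff:
  "gdist E x y = enat 0 \<longleftrightarrow> (x, y) \<in> rel 0"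
  "gdist E x y = enat 1 \<longleftrightarrow> (x, y) \<in> rel (Suc 0)"
  "gdist E x y = enat 2 \<longleftrightarrow> (x, y) \<in> rel 2"
  "gdist E x y = enat 3 \<longleftrightarrow> (x, y) \<in> rel 3 \<or> (x, y) \<in> rel 4"
  "gdist E x y = enat 4 \<longleftrightarrow> (x, y) \<in> rel 5"
proof -
  show "gdist E x y = enat 0 \<longleftrightarrow> (x, y) \<in> rel 0"
    using gdist_rel[of x y] by (cases rule: rel_cases[of x y]) (simp_all del: rel_simps, auto simp del: rel_simps)
  show "gdist E x y = enat 1 \<longleftrightarrow> (x, y) \<in> rel (Suc 0)"
    using gdist_rel[of x y] by (cases rule: rel_cases[of x y]) (simp_all del: rel_simps, auto simp del: rel_simps)
  show "gdist E x y = enat 2 \<longleftrightarrow> (x, y) \<in> rel 2"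
    using gdist_rel[of x y] by (cases rule: rel_cases[of x y]) (simp_all del: rel_simps, auto simp del: rel_simps)
  show "gdist E x y = enat 3 \<longleftrightarrow> (x, y) \<in> rel 3 \<or> (x, y) \<in> rel 4"
    using gdist_rel[of x y] by (cases rule: rel_cases[of x y]) (simp_all del: rel_simps, auto simp del: rel_simps)
  show "gdist E x y = enat 4 \<longleftrightarrow> (x, y) \<in> rel 5"
    using gdist_rel[of x y] by (cases rule: rel_cases[of x y]) (simp_all del: rel_simps, auto simp del: rel_simps)
qed

lemma gsphere_rel:
  "E `` {x} = {y. (x, y) \<in> rel (Suc 0)}"
  "gsphere E 2 x = {y. (x, y) \<in> rel 2}"
  "gsphere E 3 x = {y. (x, y) \<in> rel 3 \<or> (x, y) \<in> rel 4}"
  "gsphere E 4 x = {y. (x, y) \<in> rel 5}"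
  unfolding gsphere_def gdist_eq_iff by auto

text \<open>The vertices at distance 4 are the group mates of \<open>x\<close>, so having a
  neighbour there means being adjacent to a mate. For a pair in \<open>rel 3\<close> the mate
  differs from \<open>x\<close> because the pair is not an edge.\<close>

lemma gsphere3'_rel: "gsphere3' E x = {y. (x, y) \<in> rel 3}"
proof -
  have "(x, y) \<in> rel 3 \<longleftrightarrow> ((x, y) \<in> rel 3 \<or> (x, y) \<in> rel 4) \<and> E `` {y} \<inter> {z. (x, z) \<in> rel 5} \<noteq> {}" for y
    using edge_sym by auto
  then show ?thesis unfolding gsphere3'_def gsphere_rel by auto
qed

lemma gsphere3''_rel: "gsphere3'' E x = {y. (x, y) \<in> rel 4}"
  unfolding gsphere3''_def gsphere3'_rel gsphere_rel by auto

lemmas sphere_rel = gsphere_rel(1,2,4) gsphere3'_rel gsphere3''_rel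

lemma gdiameter_eq: "gdiameter E = 4"
proof (rule antisym)
  have "gdist E x y \<le> 4" for x y
    using gdist_rel[of x y]
    by (cases rule: rel_cases[of x y]) (auto simp del: rel_simps simp: numeral_eq_enat)
  then show "gdiameter E \<le> 4"
    unfolding gdiameter_def by (intro SUP_least)
  fix x
  obtain y where "(x, y) \<in> rel 5" using ex_group_mate by auto
  then have "gdist E x y = 4" using gdist_rel_5 by (simp add: numeral_eq_enat)
  moreover have "gdist E x y \<le> gdiameter E"
    unfolding gdiameter_def by (meson SUP_upper2 SUP_upper UNIV_I)
  ultimately show "4 \<le> gdiameter E" by simp
qed

lemma bipartite: "bipartite E"
  unfolding bipartite_def using edge_side by (intro exI[of _ "{x. s x}"]) auto

lemma walk_regular_2: "walk_regular 2 E"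
  unfolding walk_regular_def
proof (intro conjI allI impI)
  show "enat 2 \<le> gdiameter E" by (simp add: gdiameter_eq numeral_eq_enat)
  fix l x y x' y'
  assume h: "gdist E x y \<le> enat 2 \<and> gdist E x' y' = gdist E x y"
  then obtain j where j: "gdist E x y = enat j" "j \<le> 2"
    by (metis enat_ile enat_ord_simps(1))
  \<comment> \<open>Up to 2, the distance is also the index of the relation, so equal distances put
    both pairs into one relation.\<close>
  then have "j = 0 \<or> j = 1 \<or> j = 2" by auto
  then have rel: "(x, y) \<in> rel j" "(x', y') \<in> rel j"
    using h j gdist_eq_iff[of x y] gdist_eq_iff[of x' y'] by (auto simp del: rel_simps)
  have "mat 1 \<in> span basis" "A \<in> span basis"
    by (auto intro: span_base simp: basis_def)
  then have "((**) A ^^ l) (mat 1) \<in> span basis"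
    by (induction l) (auto intro: span_basis_mult)
  then have "((**) A ^^ l) (mat 1) $ x $ y = ((**) A ^^ l) (mat 1) $ x' $ y'"
    using rel j(2) by (intro matrix_in_span_const) auto
  then have "real (card (walks E l x y)) = real (card (walks E l x' y'))"
    unfolding card_walks_eq_matrix_power A_def .
  then show "card (walks E l x y) = card (walks E l x' y')" by simp
qed

section \<open>Neighbour counts and cardinalities as matrix entries\<close>

lemma nbrs_in_rel: "real (nbrs_in E y {z. (x, z) \<in> rel j}) = (adj_matrix (rel j) ** A) $ x $ y"
proof -
  have "E `` {y} \<inter> {z. (x, z) \<in> rel j} = {z. (x, z) \<in> rel j \<and> (z, y) \<in> E}"
    using edge_sym by blast
  then show ?thesis unfolding nbrs_in_def A_def adj_matrix_mult_nth by simp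
qed

text \<open>\<open>S + T\<close> is the all-ones matrix, so every entry of a row of the product is
  the row sum; the diagonal one is a convenient choice.\<close>

lemma card_rel: "real (card {z. (x, z) \<in> rel j}) = (adj_matrix (rel j) ** (S + T)) $ x $ x"
proof -
  have "S + T = adj_matrix UNIV" by (auto simp: S_def T_def vec_eq_iff)
  then show ?thesis by (simp add: adj_matrix_mult_nth)
qed

text \<open>By \<open>nbrs_in_rel\<close> the entries of these products are the neighbour counts of
  the equitable partition; the factor \<open>l2 * (n - 1)\<close> is b2' and
  \<open>k - n * l2\<close> is b2''.\<close>

lemma rel_mult_A:
  "adj_matrix (rel 0) ** A = A"
  "adj_matrix (rel (Suc 0)) ** A = real k *\<^sub>R mat 1 + real l2 *\<^sub>R (S - K)"
  "adj_matrix (rel 2) ** A = real k *\<^sub>R T - K ** A"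
  "adj_matrix (rel 3) ** A = real k *\<^sub>R (K - mat 1) + (real l2 * (real n - 1)) *\<^sub>R (S - K)"
  "adj_matrix (rel 4) ** A = (real k - real n * real l2) *\<^sub>R (S - K)"
  "adj_matrix (rel 5) ** A = K ** A - A"
proof -
  have KAA: "(K ** A) ** A = real k *\<^sub>R K + (real l2 * real n) *\<^sub>R (S - K)"
    by (simp add: matrix_mul_assoc[symmetric] AA matrix_mult_linear_simps KS KK scaleR_diff_right)
  show "adj_matrix (rel 3) ** A = real k *\<^sub>R (K - mat 1) + (real l2 * (real n - 1)) *\<^sub>R (S - K)"
    "adj_matrix (rel 4) ** A = (real k - real n * real l2) *\<^sub>R (S - K)"
    unfolding adj_rel matrix_mult_linear_simps KAA AA TA
    by (simp_all add: algebra_simps)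
qed (simp_all add: adj_rel matrix_mult_linear_simps AA SA del: rel_simps)

lemma rel_mult_J:
  "adj_matrix (rel (Suc 0)) ** (S + T) = real k *\<^sub>R (S + T)"
  "adj_matrix (rel 2) ** (S + T) = (real m * real n - real n) *\<^sub>R (S + T)"
  "adj_matrix (rel 3) ** (S + T) = (real k * (real n - 1)) *\<^sub>R (S + T)"
  "adj_matrix (rel 4) ** (S + T) = (real m * real n - real k * real n) *\<^sub>R (S + T)"
  "adj_matrix (rel 5) ** (S + T) = (real n - 1) *\<^sub>R (S + T)"
  unfolding adj_rel
  by (simp_all add: matrix_mult_linear_simps matrix_mul_assoc[symmetric] AS AT SS ST TS TT KS KT algebra_simps)

lemma S_T_diag: "(S + T) $ x $ x = 1"
  by (simp add: S_def T_def)

text \<open>The row sums come out in terms of \<open>m\<close>; the identity \<open>kk\<close>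
  trades \<open>m\<close> for \<open>k\<close> and \<open>l2\<close>.\<close>

lemma card_spheres:
  "real (card {z. (x, z) \<in> rel (Suc 0)}) = real k"
  "real (card {z. (x, z) \<in> rel 2}) = real k * (real k - 1) / real l2"
  "real (card {z. (x, z) \<in> rel 3}) = real k * (real n - 1)"
  "real (card {z. (x, z) \<in> rel 4}) = (real k - 1) * (real k - real n * real l2) / real l2"
  "real (card {z. (x, z) \<in> rel 5}) = real n - 1"
proof -
  have kk': "real k * (real k - 1) = real l2 * (real m * real n - real n)"
    using kk by (simp add: algebra_simps)
  have l2: "real l2 \<noteq> 0" using l2_ge by simp
  show "real (card {z. (x, z) \<in> rel 2}) = real k * (real k - 1) / real l2"
    unfolding kk' card_rel rel_mult_J vector_scaleR_component S_T_diag using l2 by simp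
  have "(real k - 1) * (real k - real n * real l2) = real l2 * (real m * real n - real k * real n)"
    using kk' by (simp add: algebra_simps)
  then show "real (card {z. (x, z) \<in> rel 4}) = (real k - 1) * (real k - real n * real l2) / real l2"
    unfolding card_rel rel_mult_J vector_scaleR_component S_T_diag using l2 by simp
qed (simp_all only: card_rel rel_mult_J vector_scaleR_component S_T_diag real_scaleR_def mult_1_right)

text \<open>A table of the six generators on the six relations, from which a count can be read off
  once it is expanded in generators.\<close>

lemma rel_entries:
  "(x, y) \<in> rel 0 \<Longrightarrow> K $ x $ y = 1 \<and> S $ x $ y = 1 \<and> A $ x $ y = 0 \<and> (K ** A) $ x $ y = 0 \<and> T $ x $ y = 0 \<and> mat 1 $ x $ y = (1::real)"
  "(x, y) \<in> rel (Suc 0) \<Longrightarrow> K $ x $ y = 0 \<and> S $ x $ y = 0 \<and> A $ x $ y = 1 \<and> (K ** A) $ x $ y = 1 \<and> T $ x $ y = 1 \<and> mat 1 $ x $ y = (0::real)"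
  "(x, y) \<in> rel 2 \<Longrightarrow> K $ x $ y = 0 \<and> S $ x $ y = 1 \<and> A $ x $ y = 0 \<and> (K ** A) $ x $ y = 0 \<and> T $ x $ y = 0 \<and> mat 1 $ x $ y = (0::real)"
  "(x, y) \<in> rel 3 \<Longrightarrow> K $ x $ y = 0 \<and> S $ x $ y = 0 \<and> A $ x $ y = 0 \<and> (K ** A) $ x $ y = 1 \<and> T $ x $ y = 1 \<and> mat 1 $ x $ y = (0::real)"
  "(x, y) \<in> rel 4 \<Longrightarrow> K $ x $ y = 0 \<and> S $ x $ y = 0 \<and> A $ x $ y = 0 \<and> (K ** A) $ x $ y = 0 \<and> T $ x $ y = 1 \<and> mat 1 $ x $ y = (0::real)"
  "(x, y) \<in> rel 5 \<Longrightarrow> K $ x $ y = 1 \<and> S $ x $ y = 1 \<and> A $ x $ y = 0 \<and> (K ** A) $ x $ y = 0 \<and> T $ x $ y = 0 \<and> mat 1 $ x $ y = (0::real)"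
proof -
  have KA: "(K ** A) $ x $ y = 0" if "s x = s y"
    using that edge_side Q_side unfolding KA_nth by (smt (verit))
  have self: "\<exists>z. Q x z \<and> (z, y) \<in> E" if "(x, y) \<in> E"
    using that Q_refl by blast
  have ent: "K $ x $ y = (if Q x y then 1 else 0)" "S $ x $ y = (if s x = s y then 1 else 0)"
    "T $ x $ y = (if s x \<noteq> s y then 1 else 0)" "A $ x $ y = (if (x, y) \<in> E then 1 else 0)"
    "mat 1 $ x $ y = (if x = y then 1 else 0 :: real)"
    by (auto simp: K_def S_def T_def A_def mat_def)
  show "K $ x $ y = 1 \<and> S $ x $ y = 1 \<and> A $ x $ y = 0 \<and> (K ** A) $ x $ y = 0 \<and> T $ x $ y = 0 \<and> mat 1 $ x $ y = (1::real)" if "(x, y) \<in> rel 0"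
  proof -
    have side: "s x = s y" using that rel_side(1) by blast
    then have "(x, y) \<notin> E" using edge_side by blast
    then show ?thesis using that side unfolding KA[OF side] ent by simp
  qed
  show "(x, y) \<in> rel (Suc 0) \<Longrightarrow> K $ x $ y = 0 \<and> S $ x $ y = 0 \<and> A $ x $ y = 1 \<and> (K ** A) $ x $ y = 1 \<and> T $ x $ y = 1 \<and> mat 1 $ x $ y = (0::real)"
    using rel_side(2)[of x y] Q_side[of x y] self unfolding KA_nth ent by auto
  show "K $ x $ y = 0 \<and> S $ x $ y = 1 \<and> A $ x $ y = 0 \<and> (K ** A) $ x $ y = 0 \<and> T $ x $ y = 0 \<and> mat 1 $ x $ y = (0::real)" if "(x, y) \<in> rel 2"
  proof -
    have side: "s x = s y" using that rel_side(1) by blast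
    then have "(x, y) \<notin> E" using edge_side by blast
    then show ?thesis using that side unfolding KA[OF side] ent by auto
  qed
  show "(x, y) \<in> rel 3 \<Longrightarrow> K $ x $ y = 0 \<and> S $ x $ y = 0 \<and> A $ x $ y = 0 \<and> (K ** A) $ x $ y = 1 \<and> T $ x $ y = 1 \<and> mat 1 $ x $ y = (0::real)"
    using rel_side(2)[of x y] Q_side[of x y] self unfolding KA_nth ent by auto
  show "(x, y) \<in> rel 4 \<Longrightarrow> K $ x $ y = 0 \<and> S $ x $ y = 0 \<and> A $ x $ y = 0 \<and> (K ** A) $ x $ y = 0 \<and> T $ x $ y = 1 \<and> mat 1 $ x $ y = (0::real)"
    using rel_side(2)[of x y] Q_side[of x y] self unfolding KA_nth ent by auto
  show "K $ x $ y = 1 \<and> S $ x $ y = 1 \<and> A $ x $ y = 0 \<and> (K ** A) $ x $ y = 0 \<and> T $ x $ y = 0 \<and> mat 1 $ x $ y = (0::real)" if "(x, y) \<in> rel 5"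
  proof -
    have side: "s x = s y" using that rel_side(1) by blast
    then have "(x, y) \<notin> E" using edge_side by blast
    then show ?thesis using that side unfolding KA[OF side] ent by simp
  qed
qed

lemma local_counts:
  "(x, y) \<in> rel 0 \<Longrightarrow> real (nbrs_in E y {z. (x, z) \<in> rel (Suc 0)}) = real k"
  "(x, y) \<in> rel (Suc 0) \<Longrightarrow> real (nbrs_in E y {z. (x, z) \<in> rel 0}) = 1"
  "(x, y) \<in> rel (Suc 0) \<Longrightarrow> real (nbrs_in E y {z. (x, z) \<in> rel 2}) = real k - 1"
  "(x, y) \<in> rel 2 \<Longrightarrow> real (nbrs_in E y {z. (x, z) \<in> rel (Suc 0)}) = real l2"
  "(x, y) \<in> rel 2 \<Longrightarrow> real (nbrs_in E y {z. (x, z) \<in> rel 3}) = real l2 * (real n - 1)"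
  "(x, y) \<in> rel 2 \<Longrightarrow> real (nbrs_in E y {z. (x, z) \<in> rel 4}) = real k - real n * real l2"
  "(x, y) \<in> rel 3 \<Longrightarrow> real (nbrs_in E y {z. (x, z) \<in> rel 2}) = real k - 1"
  "(x, y) \<in> rel 3 \<Longrightarrow> real (nbrs_in E y {z. (x, z) \<in> rel 5}) = 1"
  "(x, y) \<in> rel 4 \<Longrightarrow> real (nbrs_in E y {z. (x, z) \<in> rel 2}) = real k"
  "(x, y) \<in> rel 5 \<Longrightarrow> real (nbrs_in E y {z. (x, z) \<in> rel 3}) = real k"
  unfolding nbrs_in_rel rel_mult_A
  by (simp_all add: rel_entries del: rel_simps)

section \<open>Equitability and the association scheme axioms\<close>

lemma equitable_rel: "equitable E ((\<lambda>i. {y. (x, y) \<in> rel i}) ` {..5} - {{}})"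
  unfolding equitable_def
proof (intro conjI ballI)
  let ?P = "\<lambda>i. {y. (x, y) \<in> rel i}"
  \<comment> \<open>\<open>partition_on\<close> forbids empty parts, and the cell of
    \<open>rel 4\<close> is empty when \<open>k = n * l2\<close>.\<close>
  show "partition_on UNIV (?P ` {..5} - {{}})"
  proof (rule partition_onI)
    show "\<Union> (?P ` {..5} - {{}}) = UNIV"
    proof (rule UNIV_eq_I[symmetric])
      fix y
      obtain i where "i \<in> {..5}" "(x, y) \<in> rel i" using rel_cover by blast
      then show "y \<in> \<Union> (?P ` {..5} - {{}})" by blast
    qed
    show "disjnt p q" if pq: "p \<in> ?P ` {..5} - {{}}" "q \<in> ?P ` {..5} - {{}}" "p \<noteq> q" for p q
    proof -
      obtain i j where "i \<in> {..5}" "j \<in> {..5}" "p = ?P i" "q = ?P j" "i \<noteq> j"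
        using pq by blast
      moreover from this have "rel i \<inter> rel j = {}"
        using rel_disjoint by (simp add: disjoint_family_on_def)
      ultimately show ?thesis unfolding disjnt_def by blast
    qed
  qed auto
  fix B C y z
  assume B: "B \<in> ?P ` {..5} - {{}}" and C: "C \<in> ?P ` {..5} - {{}}" and yz: "y \<in> B" "z \<in> B"
  then obtain i j where i: "i \<le> 5" "B = ?P i" and j: "j \<le> 5" "C = ?P j" by auto
  have "A \<in> span basis" by (auto intro: span_base simp: basis_def)
  then have "adj_matrix (rel j) ** A \<in> span basis"
    using adj_rel_in_span_basis[OF j(1)] by (rule span_basis_mult[rotated])
  then have "real (nbrs_in E y C) = real (nbrs_in E z C)"
    unfolding j nbrs_in_rel using i yz by (intro matrix_in_span_const[OF _ i(1)]) auto
  then show "nbrs_in E y C = nbrs_in E z C" by simp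
qed

lemma scheme:
  assumes "k \<noteq> n * l2"
  shows "symmetric_assoc_scheme 5 rel"
  unfolding symmetric_assoc_scheme_def
proof (intro conjI allI impI)
  fix i j :: nat assume i: "i \<le> 5"
  fix x
  \<comment> \<open>Nonemptiness follows from nonzero valencies. The valency of \<open>rel 4\<close>
    has the factor \<open>k - n * l2\<close>; the others are positive because \<open>k\<close> and
    \<open>n\<close> are at least 2.\<close>
  have "real k \<noteq> real n * real l2" using assms by (metis of_nat_eq_iff of_nat_mult)
  then have "real (card {z. (x, z) \<in> rel h}) \<noteq> 0" if "h \<in> {Suc 0, 2, 3, 4, 5}" for h
    using that k_ge n_ge l2_ge by (elim insertE) (simp_all add: card_spheres del: rel_simps)
  then have ne: "card {z. (x, z) \<in> rel h} \<noteq> 0" if "h \<in> {Suc 0, 2, 3, 4, 5}" for h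
    using that by (metis of_nat_0)
  have "\<exists>z. (x, z) \<in> rel i"
  proof (cases "i = 0")
    case False
    then have "card {z. (x, z) \<in> rel i} \<noteq> 0"
      using i by (intro ne) auto
    then show ?thesis by (metis (no_types, lifting) card.empty empty_Collect_eq)
  qed auto
  then show "rel i \<noteq> {}" by auto
  show "transpose (adj_matrix (rel i)) = adj_matrix (rel i)" by (rule rel_sym[OF i])
  assume "j \<le> 5"
  then show "adj_matrix (rel i) ** adj_matrix (rel j) \<in> rel_span"
    using span_basis_mult adj_rel_in_span_basis i span_basis_subset by blast
next
  show "disjoint_family_on rel {..5}" by (rule rel_disjoint)
  show "(\<Union>i\<le>5. rel i) = UNIV" using rel_cover by auto
  show "adj_matrix (rel 0) = mat 1" by (rule adj_rel)
  have "(\<Sum>i\<le>5. adj_matrix (rel i)) = (\<Sum>i\<in>{0, Suc 0, 2, 3, 4, 5}. adj_matrix (rel i))"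
    unfolding atMost_5 ..
  also have "\<dots> = S + T" by (simp add: adj_rel del: rel_simps)
  also have "\<dots> = (\<chi> x y. 1)" by (auto simp: S_def T_def vec_eq_iff)
  finally show "(\<Sum>i\<le>5. adj_matrix (rel i)) = (\<chi> x y. 1)" .
qed


subsection \<open>Eigenvalues\<close>

text \<open>\<open>S ** (A ** A)\<close> is a multiple of \<open>S\<close>, and
  \<open>K ** (A ** A)\<close> is a multiple of \<open>K\<close> up to a multiple of
  \<open>S\<close>. So \<open>S *v v\<close>, or else \<open>K *v v\<close>, determines the square
  if it is nonzero; if both vanish, \<open>A ** A\<close> acts on \<open>v\<close> as the scalar
  \<open>k\<close>.\<close>

lemma eigenvalue_square:
  assumes "\<mu> \<in> eigenvalues A"
  shows "\<mu>\<^sup>2 \<in> {(real k)\<^sup>2, real k, real k - real n * real l2}"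
proof -
  obtain v where v: "v \<noteq> 0" "A *v v = \<mu> *\<^sub>R v"
    using assms unfolding eigenvalues_def by blast
  have AAv: "(A ** A) *v v = \<mu>\<^sup>2 *\<^sub>R v"
    by (simp add: matrix_vector_mul_assoc[symmetric] v matrix_vector_mult_scaleR power2_eq_square)
  have MAAv: "(M ** (A ** A)) *v v = \<mu>\<^sup>2 *\<^sub>R (M *v v)" for M :: "real^'v^'v"
    by (simp add: matrix_vector_mul_assoc[symmetric] v matrix_vector_mult_scaleR power2_eq_square)
  have scale: "c *\<^sub>R w = d *\<^sub>R w \<Longrightarrow> w \<noteq> 0 \<Longrightarrow> c = d" for c d and w :: "real^'v"
    by simp
  have SAA: "S ** (A ** A) = (real k)\<^sup>2 *\<^sub>R S"
    by (simp add: matrix_mul_assoc SA TA matrix_mult_linear_simps power2_eq_square)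
  have KAA: "K ** (A ** A) = (real k - real n * real l2) *\<^sub>R K + (real l2 * real n) *\<^sub>R S"
    by (simp add: AA matrix_mult_linear_simps KS KK algebra_simps)
  consider "S *v v \<noteq> 0" | "S *v v = 0" "K *v v \<noteq> 0" | "S *v v = 0" "K *v v = 0" by blast
  then show ?thesis
  proof cases
    case 1
    have "(real k)\<^sup>2 *\<^sub>R (S *v v) = \<mu>\<^sup>2 *\<^sub>R (S *v v)"
      using MAAv[of S] unfolding SAA scaleR_matrix_vector_assoc[symmetric] .
    from scale[OF this 1] show ?thesis by simp
  next
    case 2
    have "(real k - real n * real l2) *\<^sub>R (K *v v) = \<mu>\<^sup>2 *\<^sub>R (K *v v)"
      using MAAv[of K] 2
      by (simp add: KAA scaleR_matrix_vector_assoc[symmetric] matrix_vector_mult_add_rdistrib)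
    from scale[OF this 2(2)] show ?thesis by simp
  next
    case 3
    have "real k *\<^sub>R v = \<mu>\<^sup>2 *\<^sub>R v"
      using AAv 3
      by (simp add: AA scaleR_matrix_vector_assoc[symmetric] matrix_vector_mult_add_rdistrib
          matrix_vector_mult_diff_rdistrib)
    from scale[OF this v(1)] show ?thesis by simp
  qed
qed

text \<open>An eigenvector \<open>w\<close> of \<open>A\<^sup>2\<close> supported on one side yields the eigenvectors
  \<open>\<theta> w \<plusminus> A w\<close> of \<open>A\<close>; they are nonzero because \<open>A w\<close> lives on the other side.\<close>

lemma eigenvalue_pair:
  assumes "(A ** A) *v w = \<theta>\<^sup>2 *\<^sub>R w" and supp: "\<And>z. s z \<noteq> s x \<Longrightarrow> w $ z = 0"
    and x: "w $ x \<noteq> 0" and "\<theta> \<noteq> 0"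
  shows "\<theta> \<in> eigenvalues A"
proof -
  define v where "v = \<theta> *\<^sub>R w + A *v w"
  have "A *v v = \<theta> *\<^sub>R v"
    using assms(1)
    by (simp add: v_def matrix_vector_right_distrib matrix_vector_mul_assoc matrix_vector_mult_scaleR
        scaleR_add_right power2_eq_square)
  moreover have "(A *v w) $ x = 0"
    unfolding matrix_vector_mult_def A_def
    using supp edge_side by (auto intro!: sum.neutral)
  then have "v $ x \<noteq> 0" using x \<open>\<theta> \<noteq> 0\<close> by (simp add: v_def)
  then have "v \<noteq> 0" by (metis zero_index)
  ultimately show ?thesis unfolding eigenvalues_def by blast
qed

lemma mult_axis_nth: "((M::real^'v^'v) *v axis x 1) $ z = M $ z $ x"
  by (simp add: matrix_vector_mult_basis column_def)

text \<open>For the harder inclusion, \<open>eigenvalue_pair\<close> is fed the indicator of a side,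
  the difference of the indicators of two groups on one side, and the difference of two unit vectors
  within a group. \<open>S\<close> kills the last two and \<open>K\<close> the last one. Each claim
  assumes only the square of \<theta>, so it covers both signs.\<close>

lemma eigenvalues_A:
  assumes "k > n * l2"
  shows "eigenvalues A = {real k, - real k, sqrt k, - sqrt k,
    sqrt (real k - real n * real l2), - sqrt (real k - real n * real l2)}" (is "_ = ?R")
proof
  have pos: "real k - real n * real l2 > 0"
    using assms by (metis diff_gt_0_iff_gt of_nat_less_iff of_nat_mult)
  show "eigenvalues A \<subseteq> ?R"
  proof
    fix \<mu> assume "\<mu> \<in> eigenvalues A"
    then have "\<mu>\<^sup>2 \<in> {(real k)\<^sup>2, (sqrt k)\<^sup>2, (sqrt (real k - real n * real l2))\<^sup>2}"
      using eigenvalue_square pos by simp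
    then show "\<mu> \<in> ?R" unfolding power2_eq_iff insert_iff empty_iff by blast
  qed
  have k: "real k > 0" using k_ge by simp
  fix x
  obtain y where y: "s y = s x" "\<not> Q x y" using ex_other_group by blast
  obtain y' where y': "Q x y'" "x \<noteq> y'" using ex_group_mate by blast
  let ?e = "\<lambda>x. axis x (1::real) :: real^'v"
  have 1: "\<theta> \<in> eigenvalues A" if "\<theta>\<^sup>2 = (real k)\<^sup>2" for \<theta>
  proof (rule eigenvalue_pair[where w = "S *v ?e x" and x = x])
    show "(A ** A) *v (S *v ?e x) = \<theta>\<^sup>2 *\<^sub>R (S *v ?e x)"
      unfolding matrix_vector_mul_assoc matrix_mul_assoc[symmetric] AS AT that
      by (simp add: matrix_mult_linear_simps AT power2_eq_square scaleR_matrix_vector_assoc[symmetric])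
  qed (use that k in \<open>auto simp: mult_axis_nth S_def\<close>)
  have 2: "\<theta> \<in> eigenvalues A" if "\<theta>\<^sup>2 = real k - real n * real l2" for \<theta>
  proof (rule eigenvalue_pair[where w = "K *v (?e x - ?e y)" and x = x])
    have "S *v (?e x - ?e y) = 0"
      using y by (simp add: vec_eq_iff matrix_vector_mult_diff_distrib mult_axis_nth S_def)
    moreover have "(A ** A) ** K = \<theta>\<^sup>2 *\<^sub>R K + (real l2 * real n) *\<^sub>R S"
      unfolding AA that by (simp add: matrix_mult_linear_simps SK KK algebra_simps)
    ultimately show "(A ** A) *v (K *v (?e x - ?e y)) = \<theta>\<^sup>2 *\<^sub>R (K *v (?e x - ?e y))"
      unfolding matrix_vector_mul_assoc
      by (simp only: matrix_vector_mult_add_rdistrib scaleR_matrix_vector_assoc[symmetric]) simp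
    show "(K *v (?e x - ?e y)) $ z = 0" if "s z \<noteq> s x" for z
      using that y Q_side by (auto simp: matrix_vector_mult_diff_distrib mult_axis_nth K_def)
    show "(K *v (?e x - ?e y)) $ x \<noteq> 0"
      using y by (auto simp: matrix_vector_mult_diff_distrib mult_axis_nth K_def)
  qed (use that pos in auto)
  have 3: "\<theta> \<in> eigenvalues A" if "\<theta>\<^sup>2 = real k" for \<theta>
  proof (rule eigenvalue_pair[where w = "?e x - ?e y'" and x = x])
    have side: "s x = s y'" using y' Q_side by blast
    have "S *v (?e x - ?e y') = 0"
      using side by (simp add: vec_eq_iff matrix_vector_mult_diff_distrib mult_axis_nth S_def)
    moreover have "Q z x = Q z y'" for z using y' by (blast intro: Q_sym Q_trans)
    then have "K *v (?e x - ?e y') = 0"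
      by (simp add: vec_eq_iff matrix_vector_mult_diff_distrib mult_axis_nth K_def)
    ultimately show "(A ** A) *v (?e x - ?e y') = \<theta>\<^sup>2 *\<^sub>R (?e x - ?e y')"
      unfolding AA that
      by (simp only: matrix_vector_mult_add_rdistrib matrix_vector_mult_diff_rdistrib
          scaleR_matrix_vector_assoc[symmetric]) simp
    show "(?e x - ?e y') $ z = 0" if "s z \<noteq> s x" for z
      using that side by (auto simp: axis_def)
    show "(?e x - ?e y') $ x \<noteq> 0" using y' by (auto simp: axis_def)
  qed (use that k in auto)
  show "?R \<subseteq> eigenvalues A"
    using 1[of "real k"] 1[of "- real k"] 2 3 pos by simp
qed

text \<open>The positive values are strictly ordered, sqrt (k - n l2) < sqrt k < k, where the last
  inequality uses k \<ge> 2.\<close>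

lemma card_eigenvalues_A:
  assumes "k > n * l2"
  shows "card (eigenvalues A) = 6"
proof -
  have pos: "real k - real n * real l2 > 0"
    using assms by (metis diff_gt_0_iff_gt of_nat_less_iff of_nat_mult)
  have "n * l2 > 0" using n_ge l2_ge by simp
  then have "real n * real l2 > 0" by (metis of_nat_0_less_iff of_nat_mult)
  then have lt: "sqrt (real k - real n * real l2) < sqrt k" by simp
  have "real k < (real k)\<^sup>2"
    using k_ge by (simp add: power2_eq_square)
  then have "sqrt k < real k" by (rule real_less_lsqrt[rotated -1]) simp
  moreover have "card {c, - c, b, - b, a, - a} = 6" if "0 < a" "a < b" "b < c" for a b c :: real
    using that by (subst card_insert_disjoint; simp)+
  moreover have "sqrt (real k - real n * real l2) > 0" using pos by simp
  ultimately show ?thesis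
    unfolding eigenvalues_A[OF assms] using lt by blast
qed

text \<open>By \<open>local_counts\<close> the difference k - n l2 is a number of neighbours, hence
  nonnegative.\<close>

lemma n_l2_le_k: "n * l2 \<le> k"
proof -
  fix x
  obtain y where y: "s y = s x" "\<not> Q x y" using ex_other_group by blast
  then have "real k - real n * real l2 \<ge> 0"
    using local_counts(6)[of x y] of_nat_0_le_iff[of "nbrs_in E y {z. (x, z) \<in> rel 4}", where ?'a = real]
    by (simp del: rel_simps(5) of_nat_0_le_iff)
  then have "real (n * l2) \<le> real k" by simp
  then show ?thesis by (simp only: of_nat_le_iff)
qed

end


section \<open>Group divisible designs with the dual property\<close>

text \<open>One relation on the disjoint sum carries both the groups and the dual groups, so that a
  single argument treats points and blocks alike.\<close>

definition same_part :: "'p set set \<Rightarrow> 'b set set \<Rightarrow> 'p + 'b \<Rightarrow> 'p + 'b \<Rightarrow> bool" where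
  "same_part G H u v \<longleftrightarrow>
     (\<exists>g\<in>G. u \<in> Inl ` g \<and> v \<in> Inl ` g) \<or> (\<exists>h\<in>H. u \<in> Inr ` h \<and> v \<in> Inr ` h)"

lemma same_part_simps [simp]:
  "same_part G H (Inl p) (Inl q) \<longleftrightarrow> (\<exists>g\<in>G. p \<in> g \<and> q \<in> g)"
  "same_part G H (Inr b) (Inr c) \<longleftrightarrow> (\<exists>h\<in>H. b \<in> h \<and> c \<in> h)"
  "\<not> same_part G H (Inl p) (Inr b)" "\<not> same_part G H (Inr b) (Inl p)"
  by (auto simp: same_part_def)

lemma gdd_part_unique:
  assumes "gdd I G n m k l1 l2" "g \<in> G" "g' \<in> G" "p \<in> g" "p \<in> g'"
  shows "g = g'"
proof -
  have "partition_on UNIV G" using assms by (simp add: gdd_def)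
  from disjointD[OF partition_onD2[OF this] assms(2,3)] assms(4,5) show ?thesis by blast
qed

lemma gdd_part:
  assumes "gdd I G n m k l1 l2"
  shows "\<exists>g\<in>G. p \<in> g"
proof -
  have "\<Union>G = UNIV" using assms by (simp add: gdd_def partition_on_def)
  then show ?thesis by blast
qed

lemma gdd_card_part:
  assumes "gdd I G n m k l1 l2"
  shows "card {q. \<exists>g\<in>G. p \<in> g \<and> q \<in> g} = n"
proof -
  obtain g where g: "g \<in> G" "p \<in> g"
    using gdd_part[OF assms] by blast
  then have "{q. \<exists>g\<in>G. p \<in> g \<and> q \<in> g} = g"
    using gdd_part_unique[OF assms] by blast
  then show ?thesis using assms g by (simp add: gdd_def)
qed

lemma gdd_card_points:
  fixes I :: "('p::finite \<times> 'b::finite) set"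
  assumes "gdd I G n m k l1 l2"
  shows "card (UNIV :: 'p set) = m * n"
proof -
  have G: "partition_on UNIV G" "card G = m" "\<And>g. g \<in> G \<Longrightarrow> card g = n"
    using assms by (auto simp: gdd_def)
  have "card (\<Union>G) = sum card G"
    using G(1) by (intro card_Union_disjoint) (auto simp: partition_on_def disjoint_def pairwise_def disjnt_def)
  then show ?thesis using G by (simp add: partition_on_def)
qed

lemma gdd_common_blocks:
  assumes "gdd I G n m k l1 l2"
  shows "\<exists>g\<in>G. p \<in> g \<and> q \<in> g \<Longrightarrow> p \<noteq> q \<Longrightarrow> card {b. (p, b) \<in> I \<and> (q, b) \<in> I} = l1"
    and "\<not> (\<exists>g\<in>G. p \<in> g \<and> q \<in> g) \<Longrightarrow> card {b. (p, b) \<in> I \<and> (q, b) \<in> I} = l2"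
proof -
  show "\<exists>g\<in>G. p \<in> g \<and> q \<in> g \<Longrightarrow> p \<noteq> q \<Longrightarrow> card {b. (p, b) \<in> I \<and> (q, b) \<in> I} = l1"
    using assms by (auto simp: gdd_def)
  assume neq: "\<not> (\<exists>g\<in>G. p \<in> g \<and> q \<in> g)"
  obtain g where g: "g \<in> G" "p \<in> g" using gdd_part[OF assms] by blast
  obtain h where h: "h \<in> G" "q \<in> h" using gdd_part[OF assms] by blast
  have "g \<noteq> h" using neq g h by blast
  then show "card {b. (p, b) \<in> I \<and> (q, b) \<in> I} = l2"
    using assms g h unfolding gdd_def by blast
qed

lemma incidence_graph_simps [simp]:
  "(Inl p, Inr b) \<in> incidence_graph I \<longleftrightarrow> (p, b) \<in> I"
  "(Inr b, Inl p) \<in> incidence_graph I \<longleftrightarrow> (p, b) \<in> I"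
  "(Inl p, Inl q) \<notin> incidence_graph I" "(Inr b, Inr c) \<notin> incidence_graph I"
  by (auto simp: incidence_graph_def)

lemma incidence_graph_Image:
  "incidence_graph I `` {Inl p} = Inr ` (I `` {p})"
  "incidence_graph I `` {Inr b} = Inl ` (I\<inverse> `` {b})"
  by (auto simp: incidence_graph_def)

text \<open>The dual satisfies the same axioms, so the design serves the points and its dual the
  blocks. \<open>no_common\<close> expresses that the first index is 0.\<close>

lemma gdddp_divisible_incidence_graph:
  fixes I :: "('p::finite \<times> 'b::finite) set"
  assumes G: "gdd I G n m k 0 l2" and H: "gdd (I\<inverse>) H n m k 0 l2"
    and "n \<ge> 2" "m \<ge> 2" "l2 \<ge> 1"
  shows "divisible_incidence_graph (incidence_graph I) isl (same_part G H) n m k l2"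
proof
  fix x y z :: "'p + 'b" and t
  show "(x, y) \<in> incidence_graph I \<Longrightarrow> (y, x) \<in> incidence_graph I"
    by (cases x; cases y) auto
  show "(x, y) \<in> incidence_graph I \<Longrightarrow> isl x \<noteq> isl y"
    by (cases x; cases y) auto
  show "same_part G H x x"
  proof (cases x)
    case (Inl p)
    then show ?thesis using gdd_part[OF G, of p] by auto
  next
    case (Inr b)
    then show ?thesis using gdd_part[OF H, of b] by auto
  qed
  show "same_part G H x y \<Longrightarrow> same_part G H y x"
    by (cases x; cases y) auto
  show "same_part G H x z" if xyz: "same_part G H x y" "same_part G H y z"
  proof (cases y)
    case (Inl q)
    then obtain p r where "x = Inl p" "z = Inl r" using xyz by (cases x; cases z) auto
    then obtain g g' where gg': "g \<in> G" "g' \<in> G" "p \<in> g" "q \<in> g" "q \<in> g'" "r \<in> g'"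
      using xyz Inl by auto
    then have "g = g'" using gdd_part_unique[OF G] by blast
    then show ?thesis using gg' \<open>x = Inl p\<close> \<open>z = Inl r\<close> by auto
  next
    case (Inr q)
    then obtain p r where "x = Inr p" "z = Inr r" using xyz by (cases x; cases z) auto
    then obtain g g' where gg': "g \<in> H" "g' \<in> H" "p \<in> g" "q \<in> g" "q \<in> g'" "r \<in> g'"
      using xyz Inr by auto
    then have "g = g'" using gdd_part_unique[OF H] by blast
    then show ?thesis using gg' \<open>x = Inr p\<close> \<open>z = Inr r\<close> by auto
  qed
  show "same_part G H x y \<Longrightarrow> isl x = isl y"
    by (cases x; cases y) auto
  show "card {y. same_part G H x y} = n"
  proof (cases x)
    case (Inl p)
    have "{y. same_part G H x y} = Inl ` {q. \<exists>g\<in>G. p \<in> g \<and> q \<in> g}"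
      unfolding Inl same_part_def by auto
    then show ?thesis by (simp only: card_image[OF inj_Inl] gdd_card_part[OF G])
  next
    case (Inr p)
    have "{y. same_part G H x y} = Inr ` {q. \<exists>g\<in>H. p \<in> g \<and> q \<in> g}"
      unfolding Inr same_part_def by auto
    then show ?thesis by (simp only: card_image[OF inj_Inr] gdd_card_part[OF H])
  qed
  show "card {y. isl (y :: 'p + 'b) = t} = m * n"
  proof (cases t)
    case True
    then have "{y. isl (y :: 'p + 'b) = t} = range Inl" by (auto simp: isl_def)
    then show ?thesis by (simp only: card_image[OF inj_Inl] gdd_card_points[OF G])
  next
    case False
    then have "{y. isl (y :: 'p + 'b) = t} = range Inr"
      by (auto simp: isl_def) (metis sum.exhaust rangeI)
    then show ?thesis by (simp only: card_image[OF inj_Inr] gdd_card_points[OF H])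
  qed
  \<comment> \<open>The degree of a block is its size in the design; the degree of a point is its
    size as a block of the dual.\<close>
  show "card (incidence_graph I `` {x}) = k"
    using G H by (cases x) (simp_all add: incidence_graph_Image card_image gdd_def)
  show "(y, z) \<notin> incidence_graph I"
    if xy: "same_part G H x y" "x \<noteq> y" and xz: "(x, z) \<in> incidence_graph I"
  proof
    assume yz: "(y, z) \<in> incidence_graph I"
    show False
    proof (cases z)
      case (Inr b)
      then obtain p q where pq: "x = Inl p" "y = Inl q" using xz yz by (cases x; cases y) auto
      have "{b. (p, b) \<in> I \<and> (q, b) \<in> I} = {}"
        using gdd_common_blocks(1)[OF G, of p q] xy pq by simp
      then show False using xz yz pq Inr by auto
    next
      case (Inl a)
      then obtain b c where bc: "x = Inr b" "y = Inr c" using xz yz by (cases x; cases y) auto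
      have "{a. (b, a) \<in> I\<inverse> \<and> (c, a) \<in> I\<inverse>} = {}"
        using gdd_common_blocks(1)[OF H, of b c] xy bc by simp
      then show False using xz yz bc Inl by auto
    qed
  qed
  show "card (incidence_graph I `` {x} \<inter> incidence_graph I `` {y}) = l2"
    if xy: "isl x = isl y" "\<not> same_part G H x y"
  proof (cases x)
    case (Inl p)
    then obtain q where q: "y = Inl q" using xy by (cases y) auto
    have "incidence_graph I `` {x} \<inter> incidence_graph I `` {y} = Inr ` {b. (p, b) \<in> I \<and> (q, b) \<in> I}"
      unfolding Inl q incidence_graph_Image by auto
    then show ?thesis
      using gdd_common_blocks(2)[OF G, of p q] xy Inl q by (simp add: card_image)
  next
    case (Inr b)
    then obtain c where c: "y = Inr c" using xy by (cases y) auto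
    have "incidence_graph I `` {x} \<inter> incidence_graph I `` {y}
        = Inl ` {a. (b, a) \<in> I\<inverse> \<and> (c, a) \<in> I\<inverse>}"
      unfolding Inr c incidence_graph_Image by auto
    then show ?thesis
      using gdd_common_blocks(2)[OF H, of b c] xy Inr c by (simp add: card_image)
  qed
qed (use assms in auto)

text \<open>The guard b2'' \<noteq> 0 excludes the degenerate case \<open>k = n * l2\<close>: there
  \<open>gsphere3'' E x\<close> is empty, so one relation of the scheme would be empty, and the two
  eigenvalues with square \<open>k - n * l2\<close> collapse to 0. The parameters are compared as
  reals, so subtraction and division are exact.\<close>

theorem theorem3p1:
  fixes I :: "('p::finite \<times> 'b::finite) set" and G :: "'p set set"
    and n m k l2 :: nat
    and E :: "(('p + 'b) \<times> ('p + 'b)) set"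
    and k4 c2 b2' b2'' :: real
  assumes "n \<ge> 2" and "m \<ge> 2" and "k \<ge> 1" and "l2 \<ge> 1"
    and "gdddp I G n m k 0 l2"
    and "E = incidence_graph I"
    and "k4 = real n - 1" and "c2 = real l2"
    and "b2' = k4 * c2" and "b2'' = real k - (k4 + 1) * c2"
  shows
    "(b2'' \<noteq> 0 \<longrightarrow>
       (\<exists>R. symmetric_assoc_scheme 5 R \<and> E = R 1 \<and>
          (\<forall>x. {y. (x, y) \<in> R 0} = {x} \<and>
               {y. (x, y) \<in> R 1} = E `` {x} \<and>
               {y. (x, y) \<in> R 2} = gsphere E 2 x \<and>
               {y. (x, y) \<in> R 3} = gsphere3' E x \<and>
               {y. (x, y) \<in> R 4} = gsphere3'' E x \<and>
               {y. (x, y) \<in> R 5} = gsphere E 4 x))) \<and>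
     (\<forall>x. equitable E ({{x}, E `` {x}, gsphere E 2 x, gsphere3' E x, gsphere3'' E x, gsphere E 4 x} - {{}}) \<and>
        real (card (E `` {x})) = real k \<and>
        real (card (gsphere E 2 x)) = real k * (real k - 1) / c2 \<and>
        real (card (gsphere3' E x)) = real k * k4 \<and>
        real (card (gsphere3'' E x)) = (real k - 1) * b2'' / c2 \<and>
        real (card (gsphere E 4 x)) = k4 \<and>
        real (nbrs_in E x (E `` {x})) = real k \<and>
        (\<forall>y \<in> E `` {x}.
           real (nbrs_in E y {x}) = 1 \<and>
           real (nbrs_in E y (gsphere E 2 x)) = real k - 1) \<and>
        (\<forall>y \<in> gsphere E 2 x.
           real (nbrs_in E y (E `` {x})) = c2 \<and>
           real (nbrs_in E y (gsphere3' E x)) = b2' \<and>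
           real (nbrs_in E y (gsphere3'' E x)) = b2'') \<and>
        (\<forall>y \<in> gsphere3' E x.
           real (nbrs_in E y (gsphere E 2 x)) = real k - 1 \<and>
           real (nbrs_in E y (gsphere E 4 x)) = 1) \<and>
        (\<forall>y \<in> gsphere3'' E x.
           real (nbrs_in E y (gsphere E 2 x)) = real k) \<and>
        (\<forall>y \<in> gsphere E 4 x.
           real (nbrs_in E y (gsphere3' E x)) = real k)) \<and>
     bipartite E \<and> walk_regular 2 E \<and> gdiameter E = 4 \<and>
     (b2'' \<noteq> 0 \<longrightarrow> card (eigenvalues (adj_matrix E)) = 6)"
proof -
  obtain H where H: "gdd (I\<inverse>) H n m k 0 l2" and G: "gdd I G n m k 0 l2"
    using assms(5) unfolding gdddp_def by blast
  interpret divisible_incidence_graph E isl "same_part G H" n m k l2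
    using gdddp_divisible_incidence_graph[OF G H assms(1,2,4)] assms(6) by simp
  have k4: "k4 = real n - 1" and c2: "c2 = real l2" and b2': "b2' = real l2 * (real n - 1)"
    and b2'': "b2'' = real k - real n * real l2"
    using assms(7-10) by simp_all
  have parts: "{{x}, E `` {x}, gsphere E 2 x, gsphere3' E x, gsphere3'' E x, gsphere E 4 x}
      = (\<lambda>i. {y. (x, y) \<in> rel i}) ` {..5}" for x
    unfolding atMost_5 sphere_rel by (simp del: rel_simps(2-))
  have self: "{x} = {y. (x, y) \<in> rel 0}" for x
    by auto
  \<comment> \<open>As \<open>n * l2 \<le> k\<close> always holds, a nonzero b2'' amounts to the
    strict inequality that the eigenvalue count assumes.\<close>
  have strict: "b2'' \<noteq> 0 \<longleftrightarrow> n * l2 < k"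
    using n_l2_le_k unfolding b2'' by (metis eq_iff_diff_eq_0 le_neq_implies_less less_irrefl of_nat_eq_iff of_nat_mult)
  show ?thesis
  proof (intro conjI impI allI ballI)
    assume "b2'' \<noteq> 0"
    then have "symmetric_assoc_scheme 5 rel" using scheme strict by simp
    moreover have "E = rel 1" by simp
    ultimately show "\<exists>R. symmetric_assoc_scheme 5 R \<and> E = R 1 \<and>
          (\<forall>x. {y. (x, y) \<in> R 0} = {x} \<and>
               {y. (x, y) \<in> R 1} = E `` {x} \<and>
               {y. (x, y) \<in> R 2} = gsphere E 2 x \<and>
               {y. (x, y) \<in> R 3} = gsphere3' E x \<and>
               {y. (x, y) \<in> R 4} = gsphere3'' E x \<and>
               {y. (x, y) \<in> R 5} = gsphere E 4 x)"
      unfolding sphere_rel by (intro exI[of _ rel]) auto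
  next
    fix x
    show "equitable E ({{x}, E `` {x}, gsphere E 2 x, gsphere3' E x, gsphere3'' E x, gsphere E 4 x} - {{}})"
      unfolding parts by (rule equitable_rel)
    show "real (nbrs_in E x (E `` {x})) = real k"
      unfolding sphere_rel by (rule local_counts) simp
    fix y
    assume "y \<in> E `` {x}"
    then have "real (nbrs_in E y {y. (x, y) \<in> rel 0}) = 1"
      unfolding sphere_rel by (intro local_counts) simp
    then show "real (nbrs_in E y {x}) = 1"
      by (simp only: self[symmetric])
  next
    assume "b2'' \<noteq> 0"
    then show "card (eigenvalues (adj_matrix E)) = 6"
      using card_eigenvalues_A strict unfolding A_def by simp
  qed (simp_all only: sphere_rel mem_Collect_eq card_spheres local_counts k4 c2 b2' b2''
      bipartite walk_regular_2 gdiameter_eq)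
qed

end
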